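(* Let $m>1$ be an integer, let $\mathbb F$ be an algebraically closed field of characteristic $p=2$, and let $\lambda=(\lambda_1,\dots,\lambda_{2m+1})\in\mathbb F^{2m+1}$. Regard $H^1_*(\mathfrak h_m^\lambda,\mathfrak h_m^\lambda)$ as a subspace of $H^1(\mathfrak h_m,\mathfrak h_m)$, let $B$ be the explicit basis of $H^1(\mathfrak h_m,\mathfrak h_m)$ given in the context, and let $W\subseteq H^1(\mathfrak h_m,\mathfrak h_m)$ be the span of the elements of $B$ other than $$e^{2m+1}_{2m+1}+\sum_{i=1}^m e^i_i,\qquad e^{m+i}_i,\quad e^i_{m+i}\quad(1\le i\le m).$$ (1) If $\lambda_{2m+1}=0$, then $$H^1_*(\mathfrak h_m^\lambda,\mathfrak h_m^\lambda)=W\oplus\Big\langle e^{2m+1}_{2m+1}+\sum_{i=1}^m\big(e^i_i+\lambda_i e^i_{m+i}+\lambda_{m+i}e^{m+i}_i\big)\Big\rangle .$$ (2) If $\lambda_{2m+1}\neq0$, then $H^1_*(\mathfrak h_m^\lambda,\mathfrak h_m^\lambda)=W$.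
   Context: **Heisenberg algebra.** $\mathfrak h_m$ is the Lie algebra over $\mathbb F$ with basis $e_1,\dots,e_{2m+1}$ whose only non-vanishing brackets of basis vectors are $[e_i,e_{m+i}]=e_{2m+1}$ for $1\le i\le m$ (and those forced by antisymmetry). For $\lambda\in\mathbb F^{2m+1}$, $\mathfrak h_m^\lambda$ is $\mathfrak h_m$ with the $[p]$-map determined by $e_i^{[p]}=\lambda_ie_{2m+1}$; for $p=2$ and $g=\sum a_ie_i$ one has $g^{[2]}=\big(\sum_{i=1}^{2m+1}a_i^2\lambda_i+\sum_{j=1}^m a_ja_{m+j}\big)e_{2m+1}$. **Cohomology.** $H^1(\mathfrak h_m,\mathfrak h_m)=\ker d^1/\mathrm{im}\,d^0$ is the ordinary first Chevalley–Eilenberg cohomology with adjoint coefficients: $\ker d^1$ is the space of derivations and $\mathrm{im}\,d^0$ the space of inner derivations. The restricted cohomology is $H^1_*(\mathfrak h_m^\lambda,\mathfrak h_m^\lambda)=\ker d^1_*/\mathrm{im}\,d^0$, where $\ker d^1_*$ consists of the derivations $\psi$ satisfying $\psi(g^{[p]})=(\mathrm{ad}\,g)^{p-1}(\psi(g))$ for all $g$ (for $p=2$: $\psi(g^{[2]})=[g,\psi(g)]$); it is a subspace of $H^1(\mathfrak h_m,\mathfrak h_m)$. **The basis $B$.** $e^i_j:\mathfrak h_m\to\mathfrak h_m$ is the linear map sending $e_i$ to $e_j$ and all other basis vectors to $0$. A cocycle also denotes its class. For $m>1$, a basis $B$ of $H^1(\mathfrak h_m,\mathfrak h_m)$ consists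 of: - $e^{2m+1}_{2m+1}+\sum_{i=1}^m e^i_i$; - $e^i_j-e^{m+j}_{m+i}$ for $1\le i,j\le m$; - $e^{m+i}_j+e^{m+j}_i$ and $e^i_{m+j}+e^j_{m+i}$ for $1\le i<j\le m$; - $e^{m+i}_i$ and $e^i_{m+i}$ for $1\le i\le m$. *)

theory Defs
  imports
    "Jordan_Normal_Form.VS_Connect"
    "HOL-Library.Function_Algebras"
begin

section \<open>Quotients of spaces of functions\<close>

text \<open>Functions into a field, and functions into those, carry the pointwise group structure of
  \<^theory>\<open>HOL-Library.Function_Algebras\<close>. A vector space is a subset \<open>Z\<close> of such a type together with
  the scalar multiplication \<open>s\<close>. The ring multiplication of the resulting module record is not used.\<close>

definition coset_of :: "'v::ab_group_add set \<Rightarrow> 'v \<Rightarrow> 'v set" where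
  "coset_of N v = {v + n | n. n \<in> N}"

definition is_subspace :: "('f::field \<Rightarrow> 'v \<Rightarrow> 'v) \<Rightarrow> 'v::ab_group_add set \<Rightarrow> bool" where
  "is_subspace s Z \<longleftrightarrow> 0 \<in> Z \<and> (\<forall>x\<in>Z. \<forall>y\<in>Z. x + y \<in> Z) \<and> (\<forall>c. \<forall>x\<in>Z. s c x \<in> Z)"

definition quotient_space ::
    "('f::field \<Rightarrow> 'v \<Rightarrow> 'v) \<Rightarrow> 'v::ab_group_add set \<Rightarrow> 'v set \<Rightarrow> ('f, 'v set) module" where
  "quotient_space s Z N = \<lparr>
     carrier = coset_of N ` Z, mult = undefined, one = undefined,
     zero = N, add = (\<lambda>A B. {a + b | a b. a \<in> A \<and> b \<in> B}),
     smult = (\<lambda>c A. {s c a + n | a n. a \<in> A \<and> n \<in> N}) \<rparr>"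

definition internal_direct_sum ::
    "('f::field, 'v) module \<Rightarrow> 'v set \<Rightarrow> 'v set \<Rightarrow> 'v set \<Rightarrow> bool" where
  "internal_direct_sum V U W1 W2 \<longleftrightarrow>
     subspace class_ring W1 V \<and> subspace class_ring W2 V \<and>
     U = module.submodule_sum V W1 W2 \<and> W1 \<inter> W2 = {\<zero>\<^bsub>V\<^esub>}"

lemma coset_of_add:
  assumes "is_subspace s N"
  shows "{a + b | a b. a \<in> coset_of N x \<and> b \<in> coset_of N y} = coset_of N (x + y)"
proof (intro equalityI subsetI)
  fix z assume "z \<in> {a + b | a b. a \<in> coset_of N x \<and> b \<in> coset_of N y}"
  then obtain m n where mn: "m \<in> N" "n \<in> N" "z = (x + m) + (y + n)"
    by (auto simp: coset_of_def)
  then have "z = (x + y) + (m + n)" "m + n \<in> N"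
    using assms by (auto simp: is_subspace_def)
  then show "z \<in> coset_of N (x + y)" by (auto simp: coset_of_def)
next
  fix z assume "z \<in> coset_of N (x + y)"
  then obtain n where n: "n \<in> N" "z = (x + y) + n" by (auto simp: coset_of_def)
  have "z = (x + 0) + (y + n)" "0 \<in> N"
    using n assms by (auto simp: is_subspace_def add.assoc)
  then show "z \<in> {a + b | a b. a \<in> coset_of N x \<and> b \<in> coset_of N y}"
    using n(1) unfolding coset_of_def by blast
qed

lemma coset_of_scale:
  assumes "vector_space s" "is_subspace s N"
  shows "{s c a + n | a n. a \<in> coset_of N x \<and> n \<in> N} = coset_of N (s c x)"
proof (intro equalityI subsetI)
  interpret vector_space s by fact
  fix z assume "z \<in> {s c a + n | a n. a \<in> coset_of N x \<and> n \<in> N}"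
  then obtain m n where mn: "m \<in> N" "n \<in> N" "z = s c (x + m) + n"
    by (auto simp: coset_of_def)
  then have "z = s c x + (s c m + n)" "s c m + n \<in> N"
    using assms(2) by (auto simp: is_subspace_def scale_right_distrib add.assoc)
  then show "z \<in> coset_of N (s c x)" by (auto simp: coset_of_def)
next
  fix z assume "z \<in> coset_of N (s c x)"
  then obtain n where n: "n \<in> N" "z = s c (x + 0) + n" by (auto simp: coset_of_def)
  have "x + 0 \<in> coset_of N x" using assms(2) unfolding is_subspace_def coset_of_def by blast
  then show "z \<in> {s c a + n | a n. a \<in> coset_of N x \<and> n \<in> N}" using n by blast
qed

lemma coset_of_zero: "coset_of N 0 = N"
  by (auto simp: coset_of_def)

lemma vectorspace_quotient_space:
  fixes s :: "'f::field \<Rightarrow> 'v::ab_group_add \<Rightarrow> 'v"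
  assumes vs: "vector_space s" and Z: "is_subspace s Z" and N: "is_subspace s N"
  shows "vectorspace class_ring (quotient_space s Z N)"
proof -
  interpret vector_space s by fact
  let ?Q = "quotient_space s Z N"
  have add: "coset_of N x \<oplus>\<^bsub>?Q\<^esub> coset_of N y = coset_of N (x + y)" for x y
    by (simp add: quotient_space_def coset_of_add[OF N])
  have sc: "c \<odot>\<^bsub>?Q\<^esub> coset_of N x = coset_of N (s c x)" for c x
    by (simp add: quotient_space_def coset_of_scale[OF vs N])
  have zero: "\<zero>\<^bsub>?Q\<^esub> = coset_of N 0" by (simp add: quotient_space_def coset_of_zero)
  have car: "carrier ?Q = coset_of N ` Z" by (simp add: quotient_space_def)
  have neg: "- x \<in> Z" if "x \<in> Z" for x
    using Z that scale_minus_left[of 1 x] unfolding is_subspace_def by (metis scale_one)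
  have ag: "abelian_group ?Q"
  proof (intro abelian_groupI)
    fix A assume "A \<in> carrier ?Q"
    then obtain x where x: "x \<in> Z" "A = coset_of N x" by (auto simp: car)
    then show "\<exists>B\<in>carrier ?Q. B \<oplus>\<^bsub>?Q\<^esub> A = \<zero>\<^bsub>?Q\<^esub>"
      using neg by (intro bexI[of _ "coset_of N (- x)"]) (auto simp: car add zero)
  qed (use Z in \<open>auto simp: car add zero is_subspace_def add.assoc add.commute add.left_commute\<close>)
  have "module class_ring ?Q"
    using Z
    by (intro moduleI ag class_cring.is_cring)
       (auto simp: car add sc is_subspace_def scale_left_distrib scale_right_distrib)
  then show ?thesis
    using class_field.field_axioms by (simp add: vectorspace_def)
qed

lemma subspace_quotient_space:
  fixes s :: "'f::field \<Rightarrow> 'v::ab_group_add \<Rightarrow> 'v"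
  assumes vs: "vector_space s" and Z: "is_subspace s Z" and N: "is_subspace s N"
    and Y: "is_subspace s Y" "Y \<subseteq> Z"
  shows "subspace class_ring (coset_of N ` Y) (quotient_space s Z N)"
proof -
  have "vectorspace class_ring (quotient_space s Z N)"
    by (rule vectorspace_quotient_space[OF vs Z N])
  moreover from this have "module class_ring (quotient_space s Z N)"
    by (simp add: vectorspace_def)
  moreover have "N \<in> coset_of N ` Y"
    using Y(1) coset_of_zero[of N] unfolding is_subspace_def by blast
  ultimately show ?thesis
    using Y by (auto simp: subspace_def submodule_def quotient_space_def is_subspace_def
        coset_of_add[OF N] coset_of_scale[OF vs N])
qed


section \<open>First cohomology of a Lie algebra with adjoint coefficients\<close>

text \<open>The coordinate space of dimension \<open>n\<close> consists of the functions that vanish outside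
  \<open>{1..n}\<close>, so that coordinates are numbered from 1.\<close>

definition coord_space :: "nat \<Rightarrow> (nat \<Rightarrow> 'f::field) set" where
  "coord_space n = {v. \<forall>i. i \<notin> {1..n} \<longrightarrow> v i = 0}"

definition unit_vector :: "nat \<Rightarrow> nat \<Rightarrow> 'f::field" where
  "unit_vector i = (\<lambda>k. if k = i then 1 else 0)"

definition vscale :: "'f::field \<Rightarrow> (nat \<Rightarrow> 'f) \<Rightarrow> (nat \<Rightarrow> 'f)" where
  "vscale c v = (\<lambda>i. c * v i)"

type_synonym 'f endo = "(nat \<Rightarrow> 'f) \<Rightarrow> (nat \<Rightarrow> 'f)"

definition endo_scale :: "'f::field \<Rightarrow> 'f endo \<Rightarrow> 'f endo" where
  "endo_scale c \<psi> = (\<lambda>v. vscale c (\<psi> v))"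

text \<open>A linear endomorphism of the subspace \<open>L\<close> is represented by the function that extends it by 0
  outside \<open>L\<close>, so that equality of functions is equality of maps on \<open>L\<close>.\<close>

definition linear_endos :: "(nat \<Rightarrow> 'f::field) set \<Rightarrow> 'f endo set" where
  "linear_endos L = {\<psi>.
     (\<forall>x\<in>L. \<psi> x \<in> L) \<and> (\<forall>x. x \<notin> L \<longrightarrow> \<psi> x = 0) \<and>
     (\<forall>x\<in>L. \<forall>y\<in>L. \<psi> (x + y) = \<psi> x + \<psi> y) \<and>
     (\<forall>c. \<forall>x\<in>L. \<psi> (vscale c x) = vscale c (\<psi> x))}"

definition ad_map ::
    "(nat \<Rightarrow> 'f::field) set \<Rightarrow> ((nat \<Rightarrow> 'f) \<Rightarrow> (nat \<Rightarrow> 'f) \<Rightarrow> (nat \<Rightarrow> 'f)) \<Rightarrow> (nat \<Rightarrow> 'f) \<Rightarrow> 'f endo" where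
  "ad_map L br x = (\<lambda>y. if y \<in> L then br x y else 0)"

definition derivations ::
    "(nat \<Rightarrow> 'f::field) set \<Rightarrow> ((nat \<Rightarrow> 'f) \<Rightarrow> (nat \<Rightarrow> 'f) \<Rightarrow> (nat \<Rightarrow> 'f)) \<Rightarrow> 'f endo set" where
  "derivations L br =
     {\<psi> \<in> linear_endos L. \<forall>x\<in>L. \<forall>y\<in>L. \<psi> (br x y) = br (\<psi> x) y + br x (\<psi> y)}"

definition inner_derivations ::
    "(nat \<Rightarrow> 'f::field) set \<Rightarrow> ((nat \<Rightarrow> 'f) \<Rightarrow> (nat \<Rightarrow> 'f) \<Rightarrow> (nat \<Rightarrow> 'f)) \<Rightarrow> 'f endo set" where
  "inner_derivations L br = ad_map L br ` L"

text \<open>Here \<open>pm\<close> is the p-map of \<open>L\<close>, where p is the characteristic of the field.\<close>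

definition restricted_derivations ::
    "(nat \<Rightarrow> 'f::field) set \<Rightarrow> ((nat \<Rightarrow> 'f) \<Rightarrow> (nat \<Rightarrow> 'f) \<Rightarrow> (nat \<Rightarrow> 'f)) \<Rightarrow> 'f endo \<Rightarrow> 'f endo set" where
  "restricted_derivations L br pm =
     {\<psi> \<in> derivations L br. \<forall>g\<in>L. \<psi> (pm g) = (ad_map L br g ^^ (CHAR('f) - 1)) (\<psi> g)}"

definition H1 ::
    "(nat \<Rightarrow> 'f::field) set \<Rightarrow> ((nat \<Rightarrow> 'f) \<Rightarrow> (nat \<Rightarrow> 'f) \<Rightarrow> (nat \<Rightarrow> 'f)) \<Rightarrow> ('f, 'f endo set) module" where
  "H1 L br = quotient_space endo_scale (derivations L br) (inner_derivations L br)"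

definition H1_class ::
    "(nat \<Rightarrow> 'f::field) set \<Rightarrow> ((nat \<Rightarrow> 'f) \<Rightarrow> (nat \<Rightarrow> 'f) \<Rightarrow> (nat \<Rightarrow> 'f)) \<Rightarrow> 'f endo \<Rightarrow> 'f endo set" where
  "H1_class L br = coset_of (inner_derivations L br)"

text \<open>Inner derivations are restricted, so the restricted cohomology sits in \<^const>\<open>H1\<close> as the set of
  classes of restricted derivations.\<close>

definition H1_restricted ::
    "(nat \<Rightarrow> 'f::field) set \<Rightarrow> ((nat \<Rightarrow> 'f) \<Rightarrow> (nat \<Rightarrow> 'f) \<Rightarrow> (nat \<Rightarrow> 'f)) \<Rightarrow> 'f endo \<Rightarrow> 'f endo set set" where
  "H1_restricted L br pm = H1_class L br ` restricted_derivations L br pm"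


section \<open>The Heisenberg algebra\<close>

definition heis :: "nat \<Rightarrow> (nat \<Rightarrow> 'f::field) set" where
  "heis m = coord_space (2 * m + 1)"

definition heis_bracket :: "nat \<Rightarrow> (nat \<Rightarrow> 'f::field) \<Rightarrow> (nat \<Rightarrow> 'f) \<Rightarrow> (nat \<Rightarrow> 'f)" where
  "heis_bracket m a b =
     vscale (\<Sum>i=1..m. a i * b (m + i) - a (m + i) * b i) (unit_vector (2 * m + 1))"

text \<open>The p-map with \<open>e i \<mapsto> lam i e (2m+1)\<close> in characteristic 2; see \<open>heis_pmap_unique\<close>.\<close>

definition heis_pmap :: "nat \<Rightarrow> (nat \<Rightarrow> 'f::field) \<Rightarrow> 'f endo" where
  "heis_pmap m lam a =
     vscale ((\<Sum>i=1..2*m+1. (a i)\<^sup>2 * lam i) + (\<Sum>j=1..m. a j * a (m + j)))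
       (unit_vector (2 * m + 1))"

definition elem_map :: "nat \<Rightarrow> nat \<Rightarrow> nat \<Rightarrow> 'f::field endo" where
  "elem_map m i j = (\<lambda>v. if v \<in> heis m then vscale (v i) (unit_vector j) else 0)"

definition heis_B0 :: "nat \<Rightarrow> 'f::field endo" where
  "heis_B0 m = elem_map m (2*m+1) (2*m+1) + (\<Sum>i=1..m. elem_map m i i)"

definition heis_B_squares :: "nat \<Rightarrow> 'f::field endo set" where
  "heis_B_squares m =
     {elem_map m (m+i) i | i. 1 \<le> i \<and> i \<le> m} \<union> {elem_map m i (m+i) | i. 1 \<le> i \<and> i \<le> m}"

definition heis_B :: "nat \<Rightarrow> 'f::field endo set" where
  "heis_B m =
     {heis_B0 m} \<union>
     {elem_map m i j - elem_map m (m+j) (m+i) | i j. 1 \<le> i \<and> i \<le> m \<and> 1 \<le> j \<and> j \<le> m} \<union>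
     {elem_map m (m+i) j + elem_map m (m+j) i | i j. 1 \<le> i \<and> i < j \<and> j \<le> m} \<union>
     {elem_map m i (m+j) + elem_map m j (m+i) | i j. 1 \<le> i \<and> i < j \<and> j \<le> m} \<union>
     heis_B_squares m"

abbreviation heis_H1 :: "nat \<Rightarrow> ('f::field, 'f endo set) module" where
  "heis_H1 m \<equiv> H1 (heis m) (heis_bracket m)"

abbreviation heis_class :: "nat \<Rightarrow> 'f::field endo \<Rightarrow> 'f endo set" where
  "heis_class m \<equiv> H1_class (heis m) (heis_bracket m)"

abbreviation heis_H1_restricted :: "nat \<Rightarrow> (nat \<Rightarrow> 'f::field) \<Rightarrow> 'f endo set set" where
  "heis_H1_restricted m lam \<equiv> H1_restricted (heis m) (heis_bracket m) (heis_pmap m lam)"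

definition heis_W :: "nat \<Rightarrow> 'f::field endo set set" where
  "heis_W m = LinearCombinations.module.span class_ring (heis_H1 m)
     (heis_class m ` (heis_B m - ({heis_B0 m} \<union> heis_B_squares m)))"


section \<open>Sanity checks\<close>

lemma vector_space_endo_scale: "vector_space (endo_scale :: 'f::field \<Rightarrow> 'f endo \<Rightarrow> 'f endo)"
  by unfold_locales (auto simp: endo_scale_def vscale_def fun_eq_iff algebra_simps)

lemma unit_vector_in_heis: "1 \<le> i \<Longrightarrow> i \<le> 2 * m + 1 \<Longrightarrow> unit_vector i \<in> heis m"
  by (auto simp: heis_def coord_space_def unit_vector_def)

lemma heis_add: "x \<in> heis m \<Longrightarrow> y \<in> heis m \<Longrightarrow> x + y \<in> heis m"
  and heis_vscale: "x \<in> heis m \<Longrightarrow> vscale c x \<in> heis m"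
  and heis_zero: "0 \<in> heis m"
  by (auto simp: heis_def coord_space_def vscale_def)

lemma vscale_simps:
  "vscale c (x + y) = vscale c x + vscale c y" "vscale (c + d) x = vscale c x + vscale d x"
  "vscale c (vscale d x) = vscale (c * d) x" "vscale c 0 = 0" "vscale 0 x = 0" "vscale 1 x = x"
  by (auto simp: vscale_def fun_eq_iff algebra_simps)

lemma heis_bracket_closed: "heis_bracket m a b \<in> heis m"
  unfolding heis_bracket_def by (intro heis_vscale unit_vector_in_heis) auto

lemma heis_bracket_bilinear:
  "heis_bracket m (a + a') b = heis_bracket m a b + heis_bracket m a' b"
  "heis_bracket m a (b + b') = heis_bracket m a b + heis_bracket m a b'"
  "heis_bracket m (vscale c a) b = vscale c (heis_bracket m a b)"
  "heis_bracket m a (vscale c b) = vscale c (heis_bracket m a b)"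
  by (auto simp: heis_bracket_def vscale_def unit_vector_def fun_eq_iff sum.distrib[symmetric]
      sum_distrib_left algebra_simps sum_subtractf[symmetric] intro!: sum.cong)

lemma heis_bracket_alternating: "heis_bracket m a a = 0"
  by (auto simp: heis_bracket_def vscale_def fun_eq_iff intro!: sum.neutral)

lemma heis_bracket_central: "heis_bracket m a (heis_bracket m b c) = 0"
  by (auto simp: heis_bracket_def vscale_def unit_vector_def fun_eq_iff intro!: sum.neutral)

lemma heis_bracket_central_left: "heis_bracket m (heis_bracket m a b) c = 0"
  by (auto simp: heis_bracket_def vscale_def unit_vector_def fun_eq_iff intro!: sum.neutral)

lemma heis_bracket_jacobi:
  "heis_bracket m a (heis_bracket m b c) + heis_bracket m b (heis_bracket m c a)
     + heis_bracket m c (heis_bracket m a b) = 0"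
  by (simp add: heis_bracket_central)

lemma heis_bracket_unit_vector:
  assumes "1 \<le> i" "i \<le> j" "j \<le> 2 * m + 1"
  shows "heis_bracket m (unit_vector i) (unit_vector j) =
           (if i \<le> m \<and> j = m + i then unit_vector (2 * m + 1) else 0)"
proof -
  have "(\<Sum>k=1..m. unit_vector i k * unit_vector j (m + k)
                   - unit_vector i (m + k) * unit_vector j k) =
        (\<Sum>k=1..m. if k = i then (if j = m + i then 1 else 0) else (0 :: 'a))"
    using assms by (intro sum.cong) (auto simp: unit_vector_def)
  also have "\<dots> = (if i \<le> m \<and> j = m + i then 1 else 0)"
    using assms by (simp add: sum.delta)
  finally show ?thesis
    by (auto simp: heis_bracket_def vscale_def fun_eq_iff)
qed

lemma heis_bracket_zero: "heis_bracket m 0 b = 0" "heis_bracket m a 0 = 0"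
  by (auto simp: heis_bracket_def vscale_simps)

lemma is_subspace_derivations: "is_subspace endo_scale (derivations (heis m) (heis_bracket m))"
  unfolding is_subspace_def derivations_def linear_endos_def endo_scale_def
  by (simp add: heis_add heis_vscale heis_zero
        heis_bracket_bilinear heis_bracket_closed heis_bracket_zero vscale_simps mult.commute
        add.assoc add.left_commute)

lemma is_subspace_inner_derivations:
  "is_subspace endo_scale (inner_derivations (heis m) (heis_bracket m))"
proof -
  let ?ad = "ad_map (heis m) (heis_bracket m)"
  have "?ad 0 = 0"
    by (rule ext) (simp add: ad_map_def heis_bracket_zero)
  moreover have "?ad x + ?ad y = ?ad (x + y)" for x y
    by (rule ext) (simp add: ad_map_def heis_bracket_bilinear)
  moreover have "endo_scale c (?ad x) = ?ad (vscale c x)" for c x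
    by (rule ext) (simp add: ad_map_def heis_bracket_bilinear endo_scale_def vscale_simps)
  ultimately show ?thesis
    unfolding is_subspace_def inner_derivations_def
    by (smt (verit) heis_add heis_vscale heis_zero imageE imageI)
qed

lemma ad_map_derivation:
  assumes "x \<in> heis m"
  shows "ad_map (heis m) (heis_bracket m) x \<in> derivations (heis m) (heis_bracket m)"
  using assms
  by (auto simp: derivations_def linear_endos_def ad_map_def
      heis_add heis_vscale heis_bracket_bilinear heis_bracket_closed
      heis_bracket_central heis_bracket_central_left)

lemma inner_subset_derivations:
  "inner_derivations (heis m) (heis_bracket m) \<subseteq> derivations (heis m) (heis_bracket m)"
  by (auto simp: inner_derivations_def intro: ad_map_derivation)

lemma vectorspace_heis_H1: "vectorspace class_ring (heis_H1 m :: ('f::field, _) module)"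
  unfolding H1_def
  by (rule vectorspace_quotient_space[OF vector_space_endo_scale is_subspace_derivations
        is_subspace_inner_derivations])

lemma CHAR_2_add_self:
  assumes "CHAR('f::field) = 2"
  shows "x + x = (0 :: 'f)"
proof -
  have "(2 :: 'f) = 0" using of_nat_CHAR[where 'a = 'f] assms by simp
  then show ?thesis by (metis mult_2 mult_zero_left)
qed

lemma CHAR_2_minus:
  assumes "CHAR('f::field) = 2"
  shows "- x = (x :: 'f)"
  using CHAR_2_add_self[OF assms, of x] by (simp add: minus_unique)

lemma CHAR_2_diff:
  assumes "CHAR('f::field) = 2"
  shows "x - y = x + (y :: 'f)"
  using CHAR_2_minus[OF assms, of y] by (metis diff_conv_add_uminus)

lemma CHAR_2_square_add:
  assumes "CHAR('f::field) = 2"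
  shows "(x + y)\<^sup>2 = x\<^sup>2 + (y :: 'f)\<^sup>2"
  using CHAR_2_add_self[OF assms, of "x * y"] by (simp add: power2_eq_square algebra_simps)

text \<open>\<^const>\<open>heis_pmap\<close> satisfies the axioms of a p-map for p = 2, and is the only one with the
  prescribed values on the basis.\<close>

lemma heis_pmap_restricted:
  assumes "CHAR('f::field) = 2"
  shows "heis_pmap m lam (vscale c x) = vscale (c\<^sup>2) (heis_pmap m lam (x :: nat \<Rightarrow> 'f))"
    and "heis_pmap m lam (x + y) = heis_pmap m lam x + heis_pmap m lam y + heis_bracket m x y"
    and "heis_bracket m (heis_pmap m lam x) y = heis_bracket m x (heis_bracket m x y)"
proof -
  show "heis_pmap m lam (vscale c x) = vscale (c\<^sup>2) (heis_pmap m lam x)"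
    unfolding heis_pmap_def vscale_simps
    by (simp add: vscale_def distrib_left sum_distrib_left power2_eq_square ac_simps)
  have "(\<Sum>i=1..2*m+1. ((x + y) i)\<^sup>2 * lam i) =
        (\<Sum>i=1..2*m+1. (x i)\<^sup>2 * lam i) + (\<Sum>i=1..2*m+1. (y i)\<^sup>2 * lam i)"
    by (simp only: plus_fun_apply CHAR_2_square_add[OF assms] distrib_right sum.distrib)
  moreover have "(\<Sum>j=1..m. (x + y) j * (x + y) (m + j)) =
        (\<Sum>j=1..m. x j * x (m + j)) + (\<Sum>j=1..m. y j * y (m + j))
        + (\<Sum>j=1..m. x j * y (m + j) - x (m + j) * y j)"
    unfolding sum.distrib[symmetric] CHAR_2_diff[OF assms]
    by (intro sum.cong) (auto simp: algebra_simps)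
  ultimately show "heis_pmap m lam (x + y) = heis_pmap m lam x + heis_pmap m lam y + heis_bracket m x y"
    unfolding heis_pmap_def heis_bracket_def vscale_simps(2)[symmetric] by (simp only: ac_simps)
  show "heis_bracket m (heis_pmap m lam x) y = heis_bracket m x (heis_bracket m x y)"
    by (auto simp: heis_bracket_central)
       (auto simp: heis_pmap_def heis_bracket_def vscale_def unit_vector_def fun_eq_iff
             intro!: sum.neutral)
qed

lemma heis_pmap_unit_vector:
  assumes "1 \<le> i" "i \<le> 2 * m + 1"
  shows "heis_pmap m lam (unit_vector i) = vscale (lam i) (unit_vector (2 * m + 1))"
proof -
  have "(\<Sum>k=1..2*m+1. (unit_vector i k)\<^sup>2 * lam k) = (\<Sum>k=1..2*m+1. if k = i then lam k else 0)"
    by (intro sum.cong) (auto simp: unit_vector_def)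
  also have "\<dots> = lam i" using assms by simp
  finally have "(\<Sum>k=1..2*m+1. (unit_vector i k)\<^sup>2 * lam k) = lam i" .
  moreover have "(\<Sum>j=1..m. unit_vector i j * unit_vector i (m + j)) = 0"
    by (intro sum.neutral) (auto simp: unit_vector_def)
  ultimately show ?thesis unfolding heis_pmap_def by (metis add_0_right)
qed

lemma heis_pmap_unique:
  fixes f :: "'f::field endo"
  assumes char: "CHAR('f) = 2"
    and scale: "\<And>c x. x \<in> heis m \<Longrightarrow> f (vscale c x) = vscale (c\<^sup>2) (f x)"
    and add: "\<And>x y. x \<in> heis m \<Longrightarrow> y \<in> heis m \<Longrightarrow> f (x + y) = f x + f y + heis_bracket m x y"
    and basis: "\<And>i. 1 \<le> i \<Longrightarrow> i \<le> 2 * m + 1 \<Longrightarrow>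
                  f (unit_vector i) = vscale (lam i) (unit_vector (2 * m + 1))"
    and x: "x \<in> heis m"
  shows "f x = heis_pmap m lam x"
proof -
  let ?n = "2 * m + 1"
  have trunc: "(\<lambda>i. if i \<le> k then x i else 0) \<in> heis m" for k
    using x by (auto simp: heis_def coord_space_def)
  have "k \<le> ?n \<Longrightarrow> f (\<lambda>i. if i \<le> k then x i else 0) = heis_pmap m lam (\<lambda>i. if i \<le> k then x i else 0)" for k
  proof (induction k)
    case 0
    have "(\<lambda>i. if i \<le> 0 then x i else 0) = vscale 0 0"
      using x by (auto simp: heis_def coord_space_def vscale_def fun_eq_iff)
    then show ?case
      by (simp only: scale[OF heis_zero] heis_pmap_restricted(1)[OF char])
         (simp add: vscale_simps)
  next
    case (Suc k)
    let ?t = "\<lambda>i. if i \<le> k then x i else 0" and ?u = "unit_vector (Suc k) :: nat \<Rightarrow> 'f"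
    have u: "?u \<in> heis m" using Suc.prems by (intro unit_vector_in_heis) auto
    have eq: "(\<lambda>i. if i \<le> Suc k then x i else 0) = ?t + vscale (x (Suc k)) ?u"
      by (auto simp: vscale_def unit_vector_def fun_eq_iff le_Suc_eq)
    have "f ?u = heis_pmap m lam ?u"
      using Suc.prems basis[of "Suc k"] heis_pmap_unit_vector[of "Suc k" m lam] by simp
    then show ?case
      unfolding eq add[OF trunc heis_vscale[OF u]] heis_pmap_restricted(2)[OF char]
        scale[OF u] heis_pmap_restricted(1)[OF char]
      using Suc by simp
  qed
  from this[of ?n] have "f (\<lambda>i. if i \<le> ?n then x i else 0) = heis_pmap m lam (\<lambda>i. if i \<le> ?n then x i else 0)"
    by simp
  moreover have "(\<lambda>i. if i \<le> ?n then x i else 0) = x"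
    using x by (auto simp: heis_def coord_space_def fun_eq_iff)
  ultimately show ?thesis by simp
qed

lemma heis_restricted_derivations_iff:
  fixes \<psi> :: "'f::field endo"
  assumes "CHAR('f) = 2"
  shows "\<psi> \<in> restricted_derivations (heis m) (heis_bracket m) (heis_pmap m lam) \<longleftrightarrow>
           \<psi> \<in> derivations (heis m) (heis_bracket m) \<and>
           (\<forall>g\<in>heis m. \<psi> (heis_pmap m lam g) = heis_bracket m g (\<psi> g))"
  using assms
  by (auto simp: restricted_derivations_def ad_map_def derivations_def linear_endos_def)

lemma inner_subset_restricted:
  assumes "CHAR('f::field) = 2"
  shows "inner_derivations (heis m) (heis_bracket m) \<subseteq>
           restricted_derivations (heis m) (heis_bracket m) (heis_pmap m (lam :: nat \<Rightarrow> 'f))"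
proof
  fix \<psi> :: "'f endo" assume a: "\<psi> \<in> inner_derivations (heis m) (heis_bracket m)"
  then obtain x where x: "\<psi> = ad_map (heis m) (heis_bracket m) x" by (auto simp: inner_derivations_def)
  have "heis_bracket m x (heis_pmap m lam g) = 0" for g
    by (auto simp: heis_pmap_def heis_bracket_def vscale_def unit_vector_def fun_eq_iff
             intro!: sum.neutral)
  then have "\<psi> (heis_pmap m lam g) = heis_bracket m g (\<psi> g)" for g
    by (simp add: x ad_map_def heis_bracket_central heis_bracket_zero)
  then show "\<psi> \<in> restricted_derivations (heis m) (heis_bracket m) (heis_pmap m lam)"
    using a inner_subset_derivations[of m] by (auto simp: heis_restricted_derivations_iff[OF assms])
qed

lemma subspace_heis_H1_restricted:
  assumes "CHAR('f::field) = 2"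
  shows "subspace class_ring (heis_H1_restricted m (lam :: nat \<Rightarrow> 'f)) (heis_H1 m)"
  unfolding H1_def H1_restricted_def H1_class_def
proof (rule subspace_quotient_space[OF vector_space_endo_scale is_subspace_derivations
        is_subspace_inner_derivations])
  let ?R = "restricted_derivations (heis m) (heis_bracket m) (heis_pmap m lam)"
  show "?R \<subseteq> derivations (heis m) (heis_bracket m)"
    by (auto simp: restricted_derivations_def)
  show "is_subspace endo_scale ?R"
    using is_subspace_derivations[of m, where 'a = 'f]
    unfolding is_subspace_def
    by (auto simp: heis_restricted_derivations_iff[OF assms] endo_scale_def heis_bracket_bilinear heis_bracket_zero)
qed

lemma heis_class_in_H1:
  "\<psi> \<in> derivations (heis m) (heis_bracket m) \<Longrightarrow> heis_class m \<psi> \<in> carrier (heis_H1 m)"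
  by (simp add: H1_def H1_class_def quotient_space_def)

lemma heis_bracket_antisym: "heis_bracket m x y = vscale (- 1) (heis_bracket m y x)"
proof -
  have "(\<Sum>i=1..m. x i * y (m + i) - x (m + i) * y i) = - (\<Sum>i=1..m. y i * x (m + i) - y (m + i) * x i)"
    unfolding sum_negf[symmetric] by (intro sum.cong) (auto simp: algebra_simps)
  then show ?thesis by (simp add: heis_bracket_def vscale_simps)
qed

lemma heis_bracket_unit_left:
  assumes "1 \<le> i" "i \<le> m"
  shows "heis_bracket m (unit_vector i) y = vscale (y (m + i)) (unit_vector (2 * m + 1))"
    and "heis_bracket m (unit_vector (m + i)) y = vscale (- y i) (unit_vector (2 * m + 1))"
proof -
  have "(\<Sum>k=1..m. unit_vector i k * y (m + k) - unit_vector i (m + k) * y k)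
        = (\<Sum>k=1..m. if k = i then y (m + k) else 0)"
    using assms by (intro sum.cong) (auto simp: unit_vector_def)
  then show "heis_bracket m (unit_vector i) y = vscale (y (m + i)) (unit_vector (2 * m + 1))"
    using assms by (simp add: heis_bracket_def)
  have "(\<Sum>k=1..m. unit_vector (m + i) k * y (m + k) - unit_vector (m + i) (m + k) * y k)
        = (\<Sum>k=1..m. if k = i then - y k else 0)"
    using assms by (intro sum.cong) (auto simp: unit_vector_def)
  then show "heis_bracket m (unit_vector (m + i)) y = vscale (- y i) (unit_vector (2 * m + 1))"
    using assms by (simp add: heis_bracket_def)
qed

lemma heis_bracket_unit_right:
  assumes "1 \<le> i" "i \<le> m"
  shows "heis_bracket m x (unit_vector i) = vscale (- x (m + i)) (unit_vector (2 * m + 1))"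
    and "heis_bracket m x (unit_vector (m + i)) = vscale (x i) (unit_vector (2 * m + 1))"
  using heis_bracket_unit_left[OF assms, of x]
  by (simp_all add: heis_bracket_antisym[of m x] vscale_simps)

lemma is_subspace_linear_endos: "is_subspace endo_scale (linear_endos (heis m))"
  unfolding is_subspace_def linear_endos_def endo_scale_def
  by (simp add: heis_add heis_vscale heis_zero vscale_simps mult.commute add.assoc add.left_commute)

lemma linear_endos_add:
  "\<psi> \<in> linear_endos (heis m) \<Longrightarrow> \<phi> \<in> linear_endos (heis m) \<Longrightarrow> \<psi> + \<phi> \<in> linear_endos (heis m)"
  using is_subspace_linear_endos by (auto simp: is_subspace_def)

lemma linear_endos_minus:
  assumes "\<psi> \<in> linear_endos (heis m)" "\<phi> \<in> linear_endos (heis m)"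
  shows "\<psi> - \<phi> \<in> linear_endos (heis m)"
proof -
  have "\<psi> - \<phi> = \<psi> + endo_scale (- 1) \<phi>" by (auto simp: fun_eq_iff endo_scale_def vscale_def)
  then show ?thesis using assms is_subspace_linear_endos by (metis is_subspace_def)
qed

lemma linear_endos_sum:
  assumes "\<And>i. i \<in> A \<Longrightarrow> f i \<in> linear_endos (heis m)"
  shows "sum f A \<in> linear_endos (heis m)"
  using assms is_subspace_linear_endos[of m]
  by (induction A rule: infinite_finite_induct) (auto simp: is_subspace_def)

lemma elem_map_linear:
  assumes "1 \<le> j" "j \<le> 2 * m + 1"
  shows "elem_map m i j \<in> linear_endos (heis m :: (nat \<Rightarrow> 'f::field) set)"
proof -
  have "vscale (vscale c x i) u = vscale c (vscale (x i) u)" for c and x u :: "nat \<Rightarrow> 'f"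
    by (auto simp: vscale_def)
  then show ?thesis
    using unit_vector_in_heis[OF assms, where 'a = 'f]
    by (simp add: linear_endos_def elem_map_def heis_add heis_vscale vscale_simps)
qed

lemma elem_map_bracket:
  "i \<noteq> 2 * m + 1 \<Longrightarrow> elem_map m i j (heis_bracket m x y) = 0"
  "elem_map m (2 * m + 1) (2 * m + 1) (heis_bracket m x y) = heis_bracket m x y"
  using heis_bracket_closed[of m x y]
  by (auto simp: elem_map_def heis_bracket_def vscale_def unit_vector_def fun_eq_iff)

lemma heis_B0_apply:
  assumes "x \<in> heis m"
  shows "heis_B0 m x k = (if 1 \<le> k \<and> k \<le> m \<or> k = 2 * m + 1 then x k else 0)"
proof -
  have ap: "(\<Sum>i\<in>A. f i) x k = (\<Sum>i\<in>A. f i x k)" if "finite A" for A and f :: "nat \<Rightarrow> 'a endo"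
    using that by (induction A rule: finite_induct) auto
  have "(\<Sum>i=1..m. elem_map m i i) x k = (\<Sum>i=1..m. if i = k then x i else 0)"
    unfolding ap[OF finite_atLeastAtMost] using assms
    by (intro sum.cong) (auto simp: elem_map_def vscale_def unit_vector_def)
  then show ?thesis
    using assms by (auto simp: heis_B0_def elem_map_def vscale_def unit_vector_def)
qed

lemma heis_B0_derivation:
  "(heis_B0 m :: 'f::field endo) \<in> derivations (heis m) (heis_bracket m)"
proof -
  have lin: "(heis_B0 m :: 'f endo) \<in> linear_endos (heis m)"
    unfolding heis_B0_def by (intro linear_endos_add linear_endos_sum elem_map_linear) auto
  have "heis_B0 m (heis_bracket m x y) = heis_bracket m (heis_B0 m x) y + heis_bracket m x (heis_B0 m y)"
    if "x \<in> heis m" "y \<in> heis m" for x y :: "nat \<Rightarrow> 'f"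
  proof -
    have "(\<Sum>i=1..m. x i * y (m + i) - x (m + i) * y i) =
          (\<Sum>i=1..m. heis_B0 m x i * y (m + i) - heis_B0 m x (m + i) * y i) +
          (\<Sum>i=1..m. x i * heis_B0 m y (m + i) - x (m + i) * heis_B0 m y i)"
      unfolding sum.distrib[symmetric]
      by (intro sum.cong) (auto simp: heis_B0_apply that)
    then have "heis_bracket m x y = heis_bracket m (heis_B0 m x) y + heis_bracket m x (heis_B0 m y)"
      unfolding heis_bracket_def vscale_simps(2)[symmetric] by (rule arg_cong)
    moreover have "heis_B0 m (heis_bracket m x y) = heis_bracket m x y"
      unfolding fun_eq_iff heis_B0_apply[OF heis_bracket_closed]
      by (auto simp: heis_bracket_def vscale_def unit_vector_def)
    ultimately show ?thesis by simp
  qed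
  with lin show ?thesis by (auto simp: derivations_def)
qed

lemma heis_B_subset_derivations: "heis_B m \<subseteq> derivations (heis m) (heis_bracket m)"
proof -
  have diff: "heis_bracket m (a - a') b = heis_bracket m a b - heis_bracket m a' b"
    "heis_bracket m b (a - a') = heis_bracket m b a - heis_bracket m b a'" for a a' b :: "nat \<Rightarrow> 'a"
    using heis_bracket_bilinear(1)[of m "a - a'" a' b] heis_bracket_bilinear(2)[of m b "a - a'" a']
    by (simp_all add: eq_diff_eq)
  have z: "i \<noteq> 2 * m + 1" "m + i \<noteq> 2 * m + 1" if "1 \<le> i" "i \<le> m" for i using that by auto
  note [simp] = elem_map_bracket(1)[OF z(1)] elem_map_bracket(1)[OF z(2)] heis_bracket_bilinear diff
    heis_bracket_unit_left heis_bracket_unit_right vscale_simps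
  have elem: "elem_map m i j x = vscale (x i) (unit_vector j)" if "x \<in> heis m" for i j and x :: "nat \<Rightarrow> 'a"
    using that by (simp add: elem_map_def)
  show ?thesis
    using heis_B0_derivation[of m]
    unfolding heis_B_def heis_B_squares_def derivations_def
    by (auto simp: elem intro!: linear_endos_add linear_endos_minus elem_map_linear)
       (auto simp: vscale_def fun_eq_iff)
qed

end

theory Submission
  imports Defs
begin

text \<open>Write \<open>n = 2m+1\<close>, let \<open>A\<close> be the matrix of a derivation \<open>\<psi>\<close> and \<open>\<omega>\<close> the symplectic form on the
  quotient by the centre with \<open>[x, y] = \<omega>(x, y) e\<^sub>n\<close>. The centre is spanned by a commutator, so
  \<open>\<psi> e\<^sub>n = \<mu> e\<^sub>n\<close> for a scalar \<open>\<mu>\<close>, and \<open>\<omega>(\<psi> x, y) + \<omega>(x, \<psi> y) = \<mu> \<omega>(x, y)\<close>.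

  In characteristic 2 the failure of restrictedness \<open>g \<mapsto> \<psi> (g\<^sup>[\<^sup>2\<^sup>]) - [g, \<psi> g]\<close> is additive and
  homogeneous of degree 2 for every derivation, so it vanishes as soon as it vanishes on the basis.
  There it says \<open>\<lambda>\<^sub>n \<mu> = 0\<close>, and for \<open>1 \<le> i \<le> m\<close> that the entry of \<open>A\<close> in row \<open>m+i\<close> and column
  \<open>i\<close> is \<open>\<lambda>\<^sub>i \<mu>\<close> and the entry in row \<open>i\<close> and column \<open>m+i\<close> is \<open>\<lambda>\<^sub>m\<^sub>+\<^sub>i \<mu>\<close>
  (\<open>restricted_derivation_iff_entries\<close>).

  On the other hand, \<open>W\<close> consists of the classes of the derivations for which \<open>\<mu>\<close> and all of these
  entries are 0 (\<open>heis_W_eq\<close>). Indeed, for \<open>\<mu> = 0\<close> the compatibility with \<open>\<omega>\<close> says that the two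
  diagonal blocks of \<open>A\<close> are negative transposes of each other and that the off-diagonal blocks are
  symmetric, so that \<open>A\<close> is a combination of the given basis elements, up to its last row, which is
  inner.

  If \<open>\<lambda>\<^sub>n \<noteq> 0\<close>, then restrictedness forces \<open>\<mu> = 0\<close> and the two conditions agree. If \<open>\<lambda>\<^sub>n = 0\<close>, then
  the extra generator is a restricted derivation with \<open>\<mu> = 1\<close>. Subtracting \<open>\<mu>\<close> times it moves a
  restricted derivation into \<open>W\<close>; and the sum is direct because inner derivations have \<open>\<mu> = 0\<close>, so
  that \<open>\<mu>\<close> is well defined on classes and detects the multiples of the generator.\<close>

section \<open>Spans in quotient spaces\<close>

lemma is_subspace_sum_closed:
  assumes "is_subspace s X" and "\<And>i. i \<in> A \<Longrightarrow> f i \<in> X"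
  shows "sum f A \<in> X"
  using assms by (induction A rule: infinite_finite_induct) (auto simp: is_subspace_def)

lemma is_subspace_diff:
  assumes "vector_space s" "is_subspace s X" "x \<in> X" "y \<in> X"
  shows "x - y \<in> X"
proof -
  interpret vector_space s by fact
  have "x + s (- 1) y \<in> X"
    using assms unfolding is_subspace_def by blast
  then show ?thesis by simp
qed

text \<open>The preimage in \<open>Z\<close> of the span of some classes is a subspace that contains the chosen
  representatives and \<open>N\<close>, so it contains \<open>Y\<close> by minimality. This reduces spans in the
  quotient to closure arguments in \<open>Z\<close>.\<close>

lemma span_quotient_space_eqI:
  fixes s :: "'f::field \<Rightarrow> 'v::ab_group_add \<Rightarrow> 'v"
  assumes vs: "vector_space s" and Z: "is_subspace s Z" and N: "is_subspace s N" "N \<subseteq> Z"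
    and Y: "is_subspace s Y" "Y \<subseteq> Z" and G: "G \<subseteq> Y"
    and least: "\<And>X. is_subspace s X \<Longrightarrow> G \<subseteq> X \<Longrightarrow> N \<subseteq> X \<Longrightarrow> Y \<subseteq> X"
  shows "LinearCombinations.module.span class_ring (quotient_space s Z N) (coset_of N ` G)
           = coset_of N ` Y"
proof -
  let ?Q = "quotient_space s Z N"
  interpret Q: vectorspace class_ring ?Q by (rule vectorspace_quotient_space[OF vs Z N(1)])
  have add: "coset_of N x \<oplus>\<^bsub>?Q\<^esub> coset_of N y = coset_of N (x + y)" for x y
    by (simp add: quotient_space_def coset_of_add[OF N(1)])
  have sc: "c \<odot>\<^bsub>?Q\<^esub> coset_of N x = coset_of N (s c x)" for c x
    by (simp add: quotient_space_def coset_of_scale[OF vs N(1)])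
  have zero: "\<zero>\<^bsub>?Q\<^esub> = N" by (simp add: quotient_space_def)
  have N_coset: "coset_of N x = N" if "x \<in> N" for x
  proof -
    have "z = x + (z - x)" "z - x \<in> N" if "z \<in> N" for z
      using is_subspace_diff[OF vs N(1) that \<open>x \<in> N\<close>] by auto
    then have "N \<subseteq> coset_of N x" unfolding coset_of_def by blast
    moreover have "coset_of N x \<subseteq> N" using N(1) that by (auto simp: coset_of_def is_subspace_def)
    ultimately show ?thesis by blast
  qed
  have GQ: "coset_of N ` G \<subseteq> carrier ?Q" using G Y(2) by (auto simp: quotient_space_def)
  let ?S = "Q.span (coset_of N ` G)"
  have "submodule class_ring (coset_of N ` Y) ?Q"
    using subspace_quotient_space[OF vs Z N(1) Y] by (simp add: subspace_def)
  then have "?S \<subseteq> coset_of N ` Y"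
    using G by (intro Q.span_is_subset) auto
  moreover have "Y \<subseteq> {x \<in> Z. coset_of N x \<in> ?S}"
  proof (rule least)
    have S: "submodule class_ring ?S ?Q" by (rule Q.span_is_submodule[OF GQ])
    show "is_subspace s {x \<in> Z. coset_of N x \<in> ?S}"
      using Z S zero
      by (auto simp: is_subspace_def submodule_def add[symmetric] sc[symmetric] coset_of_zero)
    show "G \<subseteq> {x \<in> Z. coset_of N x \<in> ?S}"
      using G Y(2) Q.in_own_span[OF GQ] by auto
    show "N \<subseteq> {x \<in> Z. coset_of N x \<in> ?S}"
      using N(2) S zero by (auto simp: N_coset submodule_def)
  qed
  ultimately show ?thesis by blast
qed


section \<open>Matrix entries of derivations\<close>

text \<open>Subspaces are used as an induction principle: a property of vectors that is closed under the
  vector space operations holds on the whole algebra once it holds on the basis.\<close>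

lemma heis_subset_subspace:
  assumes S: "is_subspace vscale S" and u: "\<And>i. 1 \<le> i \<Longrightarrow> i \<le> 2 * m + 1 \<Longrightarrow> unit_vector i \<in> S"
  shows "(heis m :: (nat \<Rightarrow> 'f::field) set) \<subseteq> S"
proof
  fix x :: "nat \<Rightarrow> 'f" assume x: "x \<in> heis m"
  have ap: "(\<Sum>i\<in>A. f i) k = (\<Sum>i\<in>A. f i k)" if "finite A" for A k and f :: "nat \<Rightarrow> nat \<Rightarrow> 'f"
    using that by (induction A rule: finite_induct) auto
  have "x k = (\<Sum>i=1..2*m+1. vscale (x i) (unit_vector i)) k" for k
  proof -
    have "(\<Sum>i=1..2*m+1. vscale (x i) (unit_vector i)) k = (\<Sum>i=1..2*m+1. if i = k then x i else 0)"
      unfolding ap[OF finite_atLeastAtMost]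
      by (intro sum.cong) (auto simp: vscale_def unit_vector_def)
    also have "\<dots> = x k" using x by (auto simp: heis_def coord_space_def)
    finally show ?thesis by simp
  qed
  then have "x = (\<Sum>i=1..2*m+1. vscale (x i) (unit_vector i))" by blast
  also have "\<dots> \<in> S"
    using S u by (intro is_subspace_sum_closed[OF S]) (auto simp: is_subspace_def)
  finally show "x \<in> S" .
qed

lemma linear_endo_eqI:
  assumes "\<psi> \<in> linear_endos (heis m)" "\<phi> \<in> linear_endos (heis m)"
    and "\<And>i. 1 \<le> i \<Longrightarrow> i \<le> 2 * m + 1 \<Longrightarrow> \<psi> (unit_vector i) = \<phi> (unit_vector i)"
  shows "\<psi> = \<phi>"
proof -
  have sub: "\<psi> 0 = 0" "\<phi> 0 = 0"
    using assms(1,2) heis_zero[of m] vscale_simps(5) unfolding linear_endos_def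
    by (metis (mono_tags, lifting) mem_Collect_eq)+
  have "is_subspace vscale {x \<in> heis m. \<psi> x = \<phi> x}"
    using assms(1,2) by (auto simp: is_subspace_def linear_endos_def heis_add heis_vscale heis_zero sub)
  then have "heis m \<subseteq> {x \<in> heis m. \<psi> x = \<phi> x}"
    by (rule heis_subset_subspace) (simp add: unit_vector_in_heis assms(3))
  moreover have "\<psi> x = \<phi> x" if "x \<notin> heis m" for x
    using that assms(1,2) by (simp add: linear_endos_def)
  ultimately show ?thesis by blast
qed

text \<open>The first index is the row and the second one the column, whereas the first index of
  \<^const>\<open>elem_map\<close> is the column.\<close>

definition entry :: "'f::field endo \<Rightarrow> nat \<Rightarrow> nat \<Rightarrow> 'f" where
  "entry \<psi> k i = \<psi> (unit_vector i) k"

lemma entry_simps [simp]: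
  "entry 0 k i = 0"
  "entry (\<psi> + \<phi>) k i = entry \<psi> k i + entry \<phi> k i"
  "entry (\<psi> - \<phi>) k i = entry \<psi> k i - entry \<phi> k i"
  "entry (endo_scale c \<psi>) k i = c * entry \<psi> k i"
  by (auto simp: entry_def endo_scale_def vscale_def)

lemma entry_sum [simp]: "entry (sum f A) k i = (\<Sum>a\<in>A. entry (f a) k i)"
  by (induction A rule: infinite_finite_induct)
    (simp_all only: sum.infinite sum.empty sum.insert entry_simps simp_thms)

lemma entry_elem_map:
  "1 \<le> l \<Longrightarrow> l \<le> 2 * m + 1 \<Longrightarrow>
     entry (elem_map m i j :: 'f::field endo) k l = (if l = i \<and> k = j then 1 else 0)"
  using unit_vector_in_heis[of l m, where 'a = 'f]
  by (auto simp: entry_def elem_map_def vscale_def unit_vector_def)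

lemma entry_outside:
  assumes "\<psi> \<in> linear_endos (heis m)" "1 \<le> i" "i \<le> 2 * m + 1" "k \<notin> {1..2*m+1}"
  shows "entry \<psi> k i = 0"
  using assms unit_vector_in_heis[of i m, where 'a = 'a]
  by (auto simp: entry_def linear_endos_def heis_def coord_space_def)

lemma linear_endo_matrix_expansion:
  fixes \<psi> :: "'f::field endo"
  assumes "\<psi> \<in> linear_endos (heis m)"
  shows "\<psi> = (\<Sum>i=1..2*m+1. \<Sum>k=1..2*m+1. endo_scale (entry \<psi> k i) (elem_map m i k))"
    (is "_ = ?R")
proof (rule linear_endo_eqI[OF assms])
  have scale: "endo_scale c \<phi> \<in> linear_endos (heis m)" if "\<phi> \<in> linear_endos (heis m)"
    for c and \<phi> :: "'f endo"
    using is_subspace_linear_endos[of m, where 'a = 'f] that by (auto simp: is_subspace_def)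
  show "?R \<in> linear_endos (heis m)"
    by (intro linear_endos_sum scale elem_map_linear) auto
  fix l assume l: "1 \<le> l" "l \<le> 2 * m + 1"
  have "entry ?R k l = entry \<psi> k l" for k
  proof -
    have "entry ?R k l = (\<Sum>i=1..2*m+1. \<Sum>j=1..2*m+1. if i = l then (if j = k then entry \<psi> j i else 0) else 0)"
      unfolding entry_sum entry_simps using l by (intro sum.cong) (auto simp: entry_elem_map)
    also have "\<dots> = (\<Sum>i=1..2*m+1. if i = l then (\<Sum>j=1..2*m+1. if j = k then entry \<psi> j i else 0) else 0)"
      by (intro sum.cong) auto
    also have "\<dots> = (\<Sum>j=1..2*m+1. if j = k then entry \<psi> j l else 0)" using l by simp
    also have "\<dots> = entry \<psi> k l" using entry_outside[OF assms l, of k] by auto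
    finally show ?thesis .
  qed
  then show "\<psi> (unit_vector l) = ?R (unit_vector l)" unfolding entry_def by (auto simp: fun_eq_iff)
qed

lemma vscale_unit_eq_iff: "vscale a (unit_vector n) = vscale b (unit_vector n) \<longleftrightarrow> a = b"
  by (auto simp: vscale_def unit_vector_def fun_eq_iff)

text \<open>The last basis vector is a commutator, and every bracket is a multiple of it; hence a
  derivation scales it, and the scalar is its last diagonal entry.\<close>

lemma derivation_last_unit:
  fixes \<psi> :: "'f::field endo"
  assumes m: "m \<ge> 1" and der: "\<psi> \<in> derivations (heis m) (heis_bracket m)"
  shows "\<psi> (unit_vector (2 * m + 1)) = vscale (entry \<psi> (2*m+1) (2*m+1)) (unit_vector (2 * m + 1))"
proof -
  let ?u = "unit_vector :: nat \<Rightarrow> nat \<Rightarrow> 'f"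
  have "heis_bracket m (?u 1) (?u (m + 1)) = ?u (2 * m + 1)"
    using m by (subst heis_bracket_unit_vector) auto
  moreover have "?u 1 \<in> heis m" "?u (m + 1) \<in> heis m" using m by (auto intro!: unit_vector_in_heis)
  moreover have "\<psi> (heis_bracket m x y) = heis_bracket m (\<psi> x) y + heis_bracket m x (\<psi> y)"
    if "x \<in> heis m" "y \<in> heis m" for x y
    using der that by (simp add: derivations_def)
  ultimately have "\<psi> (?u (2 * m + 1)) =
      heis_bracket m (\<psi> (?u 1)) (?u (m + 1)) + heis_bracket m (?u 1) (\<psi> (?u (m + 1)))"
    by metis
  also obtain c where "\<dots> = vscale c (?u (2 * m + 1))"
    unfolding heis_bracket_def vscale_simps(2)[symmetric] by blast
  finally show ?thesis by (auto simp: entry_def vscale_def unit_vector_def)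
qed

text \<open>A derivation that kills the centre is infinitesimally symplectic modulo the centre. Testing this
  on pairs of basis vectors makes the diagonal blocks negative transposes of each other and the
  off-diagonal blocks symmetric.\<close>

lemma derivation_block_relations:
  fixes \<psi> :: "'f::field endo"
  assumes der: "\<psi> \<in> derivations (heis m) (heis_bracket m)"
    and mu: "entry \<psi> (2*m+1) (2*m+1) = 0"
    and ij: "1 \<le> i" "i \<le> m" "1 \<le> j" "j \<le> m"
  shows "entry \<psi> (m+i) (m+j) = - entry \<psi> j i"
    and "entry \<psi> (m+j) i = entry \<psi> (m+i) j"
    and "entry \<psi> j (m+i) = entry \<psi> i (m+j)"
proof -
  let ?u = "unit_vector :: nat \<Rightarrow> nat \<Rightarrow> 'f"
  have u: "?u k \<in> heis m" if "k \<in> {i, j, m + i, m + j}" for k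
    using that ij by (auto intro!: unit_vector_in_heis)
  have lin: "\<psi> (vscale c (?u (2*m+1))) = 0" for c
  proof -
    have "\<psi> (?u (2*m+1)) = 0"
      using derivation_last_unit[OF _ der] ij mu by (simp add: vscale_simps)
    moreover have "?u (2*m+1) \<in> heis m" by (rule unit_vector_in_heis) auto
    ultimately show ?thesis using der by (simp add: derivations_def linear_endos_def vscale_simps)
  qed
  have br: "heis_bracket m (\<psi> x) y + heis_bracket m x (\<psi> y) = 0" if "x \<in> heis m" "y \<in> heis m" for x y
  proof -
    have "\<psi> (heis_bracket m x y) = 0" unfolding heis_bracket_def by (rule lin)
    then show ?thesis using der that by (simp add: derivations_def)
  qed
  note [simp] = heis_bracket_unit_left[OF ij(1,2)] heis_bracket_unit_left[OF ij(3,4)]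
    heis_bracket_unit_right[OF ij(1,2)] heis_bracket_unit_right[OF ij(3,4)] vscale_simps(2)[symmetric]
  have z: "vscale c (?u (2*m+1)) = 0 \<Longrightarrow> c = 0" for c
    using vscale_unit_eq_iff[of c "2*m+1" 0] by (simp add: vscale_simps)
  have "entry \<psi> j i + entry \<psi> (m+i) (m+j) = 0"
    using br[OF u u, of i "m + j"] by (simp add: entry_def z)
  then show "entry \<psi> (m+i) (m+j) = - entry \<psi> j i" by (simp add: eq_neg_iff_add_eq_0 add.commute)
  show "entry \<psi> (m+j) i = entry \<psi> (m+i) j"
    using z[of "- entry \<psi> (m+j) i + entry \<psi> (m+i) j"] br[OF u u, of i j] by (simp add: entry_def)
  show "entry \<psi> j (m+i) = entry \<psi> i (m+j)"
    using z[of "entry \<psi> j (m+i) - entry \<psi> i (m+j)"] br[OF u u, of "m + i" "m + j"] by (simp add: entry_def)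
qed


section \<open>Restricted derivations\<close>

text \<open>In characteristic 2 the two sides of the restrictedness condition differ by a function of \<open>g\<close>
  that is additive, because the polarisation of the p-map is the bracket and the polarisation of
  \<open>g \<mapsto> [g, \<psi> g]\<close> is \<open>\<psi> [x, y]\<close>; it is also homogeneous of degree 2. So the set where it
  vanishes is a subspace, and restrictedness can be tested on the basis.\<close>

lemma restricted_derivation_iff_entries:
  fixes \<psi> :: "'f::field endo"
  assumes ch: "CHAR('f) = 2" and m: "m \<ge> 1" and der: "\<psi> \<in> derivations (heis m) (heis_bracket m)"
  defines "mu \<equiv> entry \<psi> (2*m+1) (2*m+1)"
  shows "\<psi> \<in> restricted_derivations (heis m) (heis_bracket m) (heis_pmap m lam) \<longleftrightarrow>
     lam (2*m+1) * mu = 0 \<and>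
     (\<forall>i\<in>{1..m}. entry \<psi> (m+i) i = lam i * mu \<and> entry \<psi> i (m+i) = lam (m+i) * mu)"
proof -
  let ?u = "unit_vector :: nat \<Rightarrow> nat \<Rightarrow> 'f"
  let ?P = "\<lambda>g. \<psi> (heis_pmap m lam g) = heis_bracket m g (\<psi> g)"
  have lin: "\<psi> (x + y) = \<psi> x + \<psi> y" "\<psi> (vscale c x) = vscale c (\<psi> x)"
    if "x \<in> heis m" "y \<in> heis m" for x y c
    using der that by (auto simp: derivations_def linear_endos_def)
  have pm: "heis_pmap m lam x \<in> heis m" for x
    unfolding heis_pmap_def by (intro heis_vscale unit_vector_in_heis) auto
  have closed: "\<psi> x \<in> heis m" if "x \<in> heis m" for x
    using der that by (auto simp: derivations_def linear_endos_def)
  have sub: "is_subspace vscale {g \<in> heis m. ?P g}"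
    unfolding is_subspace_def
  proof (intro conjI ballI allI)
    have "\<psi> 0 = 0" using lin(2)[OF heis_zero heis_zero, of 0] by (simp add: vscale_simps)
    moreover have "heis_pmap m lam 0 = 0" by (auto simp: heis_pmap_def vscale_def fun_eq_iff)
    ultimately show "0 \<in> {g \<in> heis m. ?P g}" by (simp add: heis_zero heis_bracket_zero)
  next
    fix x y assume "x \<in> {g \<in> heis m. ?P g}" "y \<in> {g \<in> heis m. ?P g}"
    then have xy: "x \<in> heis m" "y \<in> heis m" "?P x" "?P y" by auto
    have sw: "heis_bracket m (\<psi> x) y = heis_bracket m y (\<psi> x)"
      using heis_bracket_antisym[of m "\<psi> x" y] by (simp add: CHAR_2_minus[OF ch] vscale_simps)
    have "\<psi> (heis_pmap m lam (x + y)) =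
        heis_bracket m x (\<psi> x) + heis_bracket m y (\<psi> y) + \<psi> (heis_bracket m x y)"
      using xy pm by (simp add: heis_pmap_restricted(2)[OF ch] lin heis_add heis_bracket_closed)
    also have "\<psi> (heis_bracket m x y) = heis_bracket m y (\<psi> x) + heis_bracket m x (\<psi> y)"
      using der xy sw by (simp add: derivations_def)
    finally have "?P (x + y)"
      by (simp only: lin(1)[OF xy(1,2)] heis_bracket_bilinear add.assoc add.commute add.left_commute)
    then show "x + y \<in> {g \<in> heis m. ?P g}" using xy by (simp add: heis_add)
  next
    fix c x assume "x \<in> {g \<in> heis m. ?P g}"
    then show "vscale c x \<in> {g \<in> heis m. ?P g}"
      using pm[of x]
      by (auto simp: heis_pmap_restricted(1)[OF ch] lin heis_bracket_bilinear vscale_simps heis_vscale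
          power2_eq_square)
  qed
  have last: "?u (2*m+1) \<in> heis m" by (rule unit_vector_in_heis) auto
  have pu: "\<psi> (heis_pmap m lam (?u i)) = vscale (lam i * mu) (?u (2*m+1))"
    if "1 \<le> i" "i \<le> 2*m+1" for i
    unfolding heis_pmap_unit_vector[OF that] lin(2)[OF last last] derivation_last_unit[OF m der]
    by (simp add: vscale_simps mu_def)
  have "?P (?u (2*m+1)) \<longleftrightarrow> lam (2*m+1) * mu = 0"
  proof -
    have "heis_bracket m (?u (2*m+1)) y = vscale 0 (?u (2*m+1))" for y
      unfolding heis_bracket_def by (subst sum.neutral) (auto simp: unit_vector_def)
    then show ?thesis using pu[of "2*m+1"] by (simp add: vscale_unit_eq_iff)
  qed
  moreover have "?P (?u i) \<longleftrightarrow> entry \<psi> (m+i) i = lam i * mu"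
    "?P (?u (m+i)) \<longleftrightarrow> entry \<psi> i (m+i) = lam (m+i) * mu" if "i \<in> {1..m}" for i
    using that pu[of i] pu[of "m+i"]
    by (auto simp: heis_bracket_unit_left vscale_unit_eq_iff entry_def CHAR_2_minus[OF ch])
  moreover have "(\<forall>g\<in>heis m. ?P g) \<longleftrightarrow>
      ?P (?u (2*m+1)) \<and> (\<forall>i\<in>{1..m}. ?P (?u i) \<and> ?P (?u (m+i)))" (is "_ \<longleftrightarrow> ?B")
  proof
    assume "\<forall>g\<in>heis m. ?P g"
    then show ?B using last by (auto intro!: unit_vector_in_heis)
  next
    assume B: ?B
    have "heis m \<subseteq> {g \<in> heis m. ?P g}"
    proof (rule heis_subset_subspace[OF sub])
      fix i :: nat assume i: "1 \<le> i" "i \<le> 2 * m + 1"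
      then consider "i \<in> {1..m}" | "i - m \<in> {1..m}" "i = m + (i - m)" | "i = 2*m+1" by force
      then have "?P (?u i)" by cases (use B in \<open>metis\<close>)+
      then show "?u i \<in> {g \<in> heis m. ?P g}" using i by (simp add: unit_vector_in_heis)
    qed
    then show "\<forall>g\<in>heis m. ?P g" by blast
  qed
  ultimately show ?thesis using der by (simp add: heis_restricted_derivations_iff[OF ch])
qed


section \<open>The subspace W\<close>

text \<open>The preimage of \<^const>\<open>heis_W\<close> under the passage to classes, described by the matrix entries
  that restrictedness constrains.\<close>

definition W_derivations :: "nat \<Rightarrow> 'f::field endo set" where
  "W_derivations m = {\<psi> \<in> derivations (heis m) (heis_bracket m).
     entry \<psi> (2*m+1) (2*m+1) = 0 \<and> (\<forall>i\<in>{1..m}. entry \<psi> (m+i) i = 0 \<and> entry \<psi> i (m+i) = 0)}"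

lemma is_subspace_W_derivations: "is_subspace endo_scale (W_derivations m)"
  using is_subspace_derivations[of m] unfolding is_subspace_def W_derivations_def by auto

text \<open>The removed basis elements are distinct from the remaining ones because each of them has an
  entry 1 that is 0 on all of \<^const>\<open>W_derivations\<close>.\<close>

lemma W_basis_eq:
  "heis_B m - ({heis_B0 m} \<union> heis_B_squares m) = (
     {elem_map m i j - elem_map m (m+j) (m+i) | i j. 1 \<le> i \<and> i \<le> m \<and> 1 \<le> j \<and> j \<le> m} \<union>
     {elem_map m (m+i) j + elem_map m (m+j) i | i j. 1 \<le> i \<and> i < j \<and> j \<le> m} \<union>
     {elem_map m i (m+j) + elem_map m j (m+i) | i j. 1 \<le> i \<and> i < j \<and> j \<le> m}
     :: 'f::field endo set)"
    (is "_ = ?G")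
  and W_basis_subset: "heis_B m - ({heis_B0 m} \<union> heis_B_squares m) \<subseteq> (W_derivations m :: 'f endo set)"
proof -
  have "?G \<subseteq> heis_B m" by (auto simp: heis_B_def)
  then have der: "?G \<subseteq> derivations (heis m) (heis_bracket m)" using heis_B_subset_derivations by blast
  then have G: "?G \<subseteq> (W_derivations m :: 'f endo set)"
  proof (intro subsetI)
    fix \<psi> :: "'f endo" assume \<psi>: "\<psi> \<in> ?G"
    then have "entry \<psi> (2*m+1) (2*m+1) = 0 \<and>
        (\<forall>i\<in>{1..m}. entry \<psi> (m+i) i = 0 \<and> entry \<psi> i (m+i) = 0)"
      by (auto simp: entry_elem_map)
    then show "\<psi> \<in> W_derivations m"
      using \<psi> der unfolding W_derivations_def by blast
  qed
  have "entry (heis_B0 m :: 'f endo) (2*m+1) (2*m+1) = 1"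
    by (simp add: heis_B0_def entry_elem_map)
  then have B0: "heis_B0 m \<notin> (W_derivations m :: 'f endo set)" by (auto simp: W_derivations_def)
  have "heis_B_squares m \<inter> (W_derivations m :: 'f endo set) = {}"
  proof -
    have "entry (elem_map m (m+i) i :: 'f endo) i (m+i) = 1"
      "entry (elem_map m i (m+i) :: 'f endo) (m+i) i = 1" if "1 \<le> i \<and> i \<le> m" for i
      using that by (auto simp: entry_elem_map)
    then show ?thesis unfolding heis_B_squares_def W_derivations_def by fastforce
  qed
  then show eq: "heis_B m - ({heis_B0 m} \<union> heis_B_squares m) = ?G"
    using G B0 unfolding heis_B_def by blast
  show "heis_B m - ({heis_B0 m} \<union> heis_B_squares m) \<subseteq> (W_derivations m :: 'f endo set)"
    unfolding eq by (rule G)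
qed

lemma sum_heis_index:
  fixes f :: "nat \<Rightarrow> 'v::ab_group_add"
  shows "(\<Sum>i=1..2*m+1. f i) = (\<Sum>i=1..m. f i) + (\<Sum>i=1..m. f (m+i)) + f (2*m+1)"
proof -
  have "(\<Sum>i=1..2*m+1. f i) = (\<Sum>i=1..m+m. f i) + f (2*m+1)" by (simp add: mult_2)
  also have "(\<Sum>i=1..m+m. f i) = (\<Sum>i=1..m. f i) + (\<Sum>i=m+1..m+m. f i)"
    by (rule sum.ub_add_nat) simp
  also have "(\<Sum>i=m+1..m+m. f i) = (\<Sum>i=1..m. f (m+i))"
    using sum.shift_bounds_cl_nat_ivl[of f 1 m m] by (simp add: add.commute)
  finally show ?thesis .
qed

lemma sum_square_pair:
  fixes f :: "nat \<Rightarrow> nat \<Rightarrow> 'v::ab_group_add"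
  shows "(\<Sum>i=1..m. \<Sum>j=1..m. f i j) = (\<Sum>i=1..m. f i i) + (\<Sum>j=1..m. \<Sum>i=1..<j. f i j + f j i)"
proof (induction m)
  case (Suc m)
  have "{1..<Suc m} = {1..m}" by auto
  with Suc show ?case by (simp add: sum.distrib add.assoc add.left_commute add.commute)
qed simp

text \<open>Expanding a derivation in elementary maps, the entries of the diagonal blocks pair up to the
  basis elements of the first kind, the symmetric off-diagonal blocks pair up to those of the other
  two kinds, and the last row is an inner derivation.\<close>

lemma W_derivations_least:
  fixes X :: "'f::field endo set"
  assumes m: "m \<ge> 1" and X: "is_subspace endo_scale X"
    and G: "heis_B m - ({heis_B0 m} \<union> heis_B_squares m) \<subseteq> X"
    and N: "inner_derivations (heis m) (heis_bracket m) \<subseteq> X"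
  shows "W_derivations m \<subseteq> X"
proof
  fix \<psi> :: "'f endo" assume "\<psi> \<in> W_derivations m"
  then have der: "\<psi> \<in> derivations (heis m) (heis_bracket m)"
    and mu: "entry \<psi> (2*m+1) (2*m+1) = 0"
    and diag: "\<And>i. i \<in> {1..m} \<Longrightarrow> entry \<psi> (m+i) i = 0" "\<And>i. i \<in> {1..m} \<Longrightarrow> entry \<psi> i (m+i) = 0"
    by (auto simp: W_derivations_def)
  have gens: "1 \<le> i \<Longrightarrow> i \<le> m \<Longrightarrow> 1 \<le> j \<Longrightarrow> j \<le> m \<Longrightarrow>
      elem_map m i j - elem_map m (m+j) (m+i) \<in> X"
    "1 \<le> i \<Longrightarrow> i < j \<Longrightarrow> j \<le> m \<Longrightarrow> elem_map m (m+i) j + elem_map m (m+j) i \<in> X"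
    "1 \<le> i \<Longrightarrow> i < j \<Longrightarrow> j \<le> m \<Longrightarrow> elem_map m i (m+j) + elem_map m j (m+i) \<in> X" for i j
    using G unfolding W_basis_eq by blast+
  note rel = derivation_block_relations[OF der mu]
  have [intro]: "x + y \<in> X" "endo_scale c x \<in> X" if "x \<in> X" "y \<in> X" for x y c
    using X that by (auto simp: is_subspace_def)
  note sumX = is_subspace_sum_closed[OF X]
  define F where "F i k = endo_scale (entry \<psi> k i) (elem_map m i k)" for i k
  have scale_add: "endo_scale c \<alpha> + endo_scale c \<beta> = endo_scale c (\<alpha> + \<beta>)"
    "endo_scale c \<alpha> + endo_scale (- c) \<beta> = endo_scale c (\<alpha> - \<beta>)"
    "endo_scale 0 \<alpha> = 0" for c and \<alpha> \<beta> :: "'f endo"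
    by (auto simp: endo_scale_def vscale_def fun_eq_iff algebra_simps)
  have lastcol: "F (2*m+1) k = 0" for k
  proof -
    have "entry \<psi> k (2*m+1) = 0"
      using derivation_last_unit[OF m der] mu by (simp add: entry_def vscale_simps)
    then show ?thesis by (simp add: F_def scale_add)
  qed
  have "\<psi> = (\<Sum>i=1..2*m+1. \<Sum>k=1..2*m+1. F i k)"
    using linear_endo_matrix_expansion[of \<psi> m] der unfolding F_def derivations_def by blast
  also have "\<dots> = (\<Sum>i=1..m. \<Sum>k=1..2*m+1. F i k) + (\<Sum>i=1..m. \<Sum>k=1..2*m+1. F (m+i) k)"
    unfolding sum_heis_index[of "\<lambda>i. \<Sum>k=1..2*m+1. F i k"] lastcol by simp
  \<comment> \<open>The diagonal blocks are grouped together since their coefficients are tied to each other.\<close>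
  also have "\<dots> = ((\<Sum>i=1..m. \<Sum>j=1..m. F i j) + (\<Sum>i=1..m. \<Sum>j=1..m. F (m+i) (m+j)))
      + (\<Sum>i=1..m. \<Sum>j=1..m. F (m+i) j) + (\<Sum>i=1..m. \<Sum>j=1..m. F i (m+j))
      + (\<Sum>i=1..m. F i (2*m+1)) + (\<Sum>i=1..m. F (m+i) (2*m+1))"
    unfolding sum_heis_index sum.distrib by (simp only: add.assoc add.left_commute add.commute)
  also have "\<dots> \<in> X"
  proof -
    have "(\<Sum>i=1..m. \<Sum>j=1..m. F i j) + (\<Sum>i=1..m. \<Sum>j=1..m. F (m+i) (m+j)) =
        (\<Sum>i=1..m. \<Sum>j=1..m. F i j + F (m+j) (m+i))"
      unfolding sum.distrib sum.swap[of "\<lambda>i j. F (m+i) (m+j)"] by simp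
    also have "\<dots> \<in> X"
    proof (intro sumX)
      fix i j assume ij: "i \<in> {1..m}" "j \<in> {1..m}"
      then have "F i j + F (m+j) (m+i) =
          endo_scale (entry \<psi> j i) (elem_map m i j - elem_map m (m+j) (m+i))"
        using rel(1)[of i j] by (simp add: F_def scale_add)
      moreover have "elem_map m i j - elem_map m (m+j) (m+i) \<in> X"
        using ij by (intro gens) auto
      ultimately show "F i j + F (m+j) (m+i) \<in> X" by auto
    qed
    finally have 1: "(\<Sum>i=1..m. \<Sum>j=1..m. F i j) + (\<Sum>i=1..m. \<Sum>j=1..m. F (m+i) (m+j)) \<in> X" .
    have 2: "(\<Sum>i=1..m. \<Sum>j=1..m. F (m+i) j) \<in> X"
      unfolding sum_square_pair[of "\<lambda>i j. F (m+i) j"]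
    proof (rule \<open>_ \<Longrightarrow> _ \<Longrightarrow> _ + _ \<in> X\<close>; intro sumX)
      fix i assume "i \<in> {1..m}"
      then show "F (m+i) i \<in> X" using X diag by (simp add: F_def scale_add is_subspace_def)
    next
      fix j i assume ij: "j \<in> {1..m}" "i \<in> {1..<j}"
      then have "F (m+i) j + F (m+j) i =
          endo_scale (entry \<psi> j (m+i)) (elem_map m (m+i) j + elem_map m (m+j) i)"
        using rel(3)[of i j] by (simp add: F_def scale_add)
      moreover have "elem_map m (m+i) j + elem_map m (m+j) i \<in> X"
        using ij by (intro gens) auto
      ultimately show "F (m+i) j + F (m+j) i \<in> X" by auto
    qed
    have 3: "(\<Sum>i=1..m. \<Sum>j=1..m. F i (m+j)) \<in> X"
      unfolding sum_square_pair[of "\<lambda>i j. F i (m+j)"]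
    proof (rule \<open>_ \<Longrightarrow> _ \<Longrightarrow> _ + _ \<in> X\<close>; intro sumX)
      fix i assume "i \<in> {1..m}"
      then show "F i (m+i) \<in> X" using X diag by (simp add: F_def scale_add is_subspace_def)
    next
      fix j i assume ij: "j \<in> {1..m}" "i \<in> {1..<j}"
      then have "F i (m+j) + F j (m+i) =
          endo_scale (entry \<psi> (m+j) i) (elem_map m i (m+j) + elem_map m j (m+i))"
        using rel(2)[of i j] by (simp add: F_def scale_add)
      moreover have "elem_map m i (m+j) + elem_map m j (m+i) \<in> X"
        using ij by (intro gens) auto
      ultimately show "F i (m+j) + F j (m+i) \<in> X" by auto
    qed
    have ad: "elem_map m (m+i) (2*m+1) \<in> X" "elem_map m i (2*m+1) \<in> X" if i: "i \<in> {1..m}" for i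
    proof -
      have adX: "ad_map (heis m) (heis_bracket m) x \<in> X" if "x \<in> heis m" for x
        using N that unfolding inner_derivations_def by blast
      have eq: "elem_map m (m+i) (2*m+1) = ad_map (heis m) (heis_bracket m) (unit_vector i :: nat \<Rightarrow> 'f)"
        "elem_map m i (2*m+1) =
           ad_map (heis m) (heis_bracket m) (vscale (- 1) (unit_vector (m+i)) :: nat \<Rightarrow> 'f)"
        using i by (auto simp: elem_map_def ad_map_def heis_bracket_unit_left heis_bracket_bilinear
            vscale_simps fun_eq_iff)
      show "elem_map m (m+i) (2*m+1) \<in> X" "elem_map m i (2*m+1) \<in> X"
        using i unfolding eq by (auto intro!: adX unit_vector_in_heis heis_vscale)
    qed
    have 4: "(\<Sum>i=1..m. F i (2*m+1)) \<in> X" "(\<Sum>i=1..m. F (m+i) (2*m+1)) \<in> X"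
      unfolding F_def using ad by (auto intro!: sumX)
    show ?thesis using 1 2 3 4 by auto
  qed
  finally show "\<psi> \<in> X" .
qed

lemma heis_W_eq:
  assumes "m \<ge> 1"
  shows "heis_W m = heis_class m ` (W_derivations m :: 'f::field endo set)"
  unfolding heis_W_def H1_def H1_class_def
proof (rule span_quotient_space_eqI[OF vector_space_endo_scale is_subspace_derivations
      is_subspace_inner_derivations inner_subset_derivations is_subspace_W_derivations _ W_basis_subset])
  show "W_derivations m \<subseteq> derivations (heis m) (heis_bracket m)" by (auto simp: W_derivations_def)
qed (rule W_derivations_least[OF assms])

lemma span_single_class:
  fixes \<tau> :: "'f::field endo"
  assumes "\<tau> \<in> derivations (heis m) (heis_bracket m)"
  shows "LinearCombinations.module.span class_ring (heis_H1 m) {heis_class m \<tau>} =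
           heis_class m ` range (\<lambda>c. endo_scale c \<tau>)"
proof -
  interpret vector_space "endo_scale :: 'f \<Rightarrow> 'f endo \<Rightarrow> 'f endo" by (rule vector_space_endo_scale)
  have "LinearCombinations.module.span class_ring (heis_H1 m) (heis_class m ` {\<tau>}) =
      heis_class m ` range (\<lambda>c. endo_scale c \<tau>)"
    unfolding H1_def H1_class_def
  proof (rule span_quotient_space_eqI[OF vector_space_endo_scale is_subspace_derivations
      is_subspace_inner_derivations inner_subset_derivations])
    have "0 = endo_scale 0 \<tau>" by simp
    then show "is_subspace endo_scale (range (\<lambda>c. endo_scale c \<tau>))"
      unfolding is_subspace_def by (auto simp: scale_left_distrib[symmetric] simp del: scale_zero_left)
    show "range (\<lambda>c. endo_scale c \<tau>) \<subseteq> derivations (heis m) (heis_bracket m)"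
      using assms is_subspace_derivations[of m] by (auto simp: is_subspace_def)
    have "\<tau> = endo_scale 1 \<tau>" by simp
    then show "{\<tau>} \<subseteq> range (\<lambda>c. endo_scale c \<tau>)" by blast
  qed (auto simp: is_subspace_def)
  then show ?thesis by simp
qed


section \<open>The restricted cohomology\<close>

theorem proposition3p3:
  fixes m :: nat and lam :: "nat \<Rightarrow> 'f::alg_closed_field"
  assumes "m > 1" and "CHAR('f) = 2" and "lam \<in> coord_space (2 * m + 1)"
  shows "(lam (2 * m + 1) = 0 \<longrightarrow>
           internal_direct_sum (heis_H1 m) (heis_H1_restricted m lam) (heis_W m)
             (LinearCombinations.module.span class_ring (heis_H1 m)
               {heis_class m (elem_map m (2*m+1) (2*m+1) +
                  (\<Sum>i=1..m. elem_map m i i + endo_scale (lam i) (elem_map m i (m+i))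
                           + endo_scale (lam (m+i)) (elem_map m (m+i) i)))})) \<and>
         (lam (2 * m + 1) \<noteq> 0 \<longrightarrow> heis_H1_restricted m lam = heis_W m)"
proof -
  have m: "m \<ge> 1" using assms by simp
  let ?D = "derivations (heis m) (heis_bracket m) :: 'f endo set"
  let ?N = "inner_derivations (heis m) (heis_bracket m) :: 'f endo set"
  let ?R = "restricted_derivations (heis m) (heis_bracket m) (heis_pmap m lam)"
  let ?n = "2 * m + 1"
  interpret H: vectorspace class_ring "heis_H1 m :: ('f, _) module" by (rule vectorspace_heis_H1)
  interpret E: vector_space "endo_scale :: 'f \<Rightarrow> 'f endo \<Rightarrow> 'f endo" by (rule vector_space_endo_scale)
  note RD = restricted_derivation_iff_entries[OF assms(2) m]
  have RsubD: "?R \<subseteq> ?D" by (auto simp: restricted_derivations_def)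
  have R_iff: "\<psi> \<in> ?R \<longleftrightarrow> \<psi> \<in> ?D \<and> lam ?n * entry \<psi> ?n ?n = 0 \<and>
     (\<forall>i\<in>{1..m}. entry \<psi> (m+i) i = lam i * entry \<psi> ?n ?n \<and> entry \<psi> i (m+i) = lam (m+i) * entry \<psi> ?n ?n)"
    for \<psi>
    using RD[of \<psi>] RsubD by blast
  have "heis_H1_restricted m lam = heis_W m" if "lam ?n \<noteq> 0"
  proof -
    \<comment> \<open>Now \<open>\<mu> = 0\<close>, and the values prescribed for the other entries become 0.\<close>
    have "?R = W_derivations m" using that by (auto simp: R_iff W_derivations_def)
    then show ?thesis by (simp add: heis_W_eq[OF m] H1_restricted_def)
  qed
  moreover have "internal_direct_sum (heis_H1 m) (heis_H1_restricted m lam) (heis_W m)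
      (LinearCombinations.module.span class_ring (heis_H1 m)
        {heis_class m (elem_map m ?n ?n +
          (\<Sum>i=1..m. elem_map m i i + endo_scale (lam i) (elem_map m i (m+i))
                   + endo_scale (lam (m+i)) (elem_map m (m+i) i)))})"
    if l0: "lam ?n = 0"
  proof -
    define \<tau> where "\<tau> = elem_map m ?n ?n +
          (\<Sum>i=1..m. elem_map m i i + endo_scale (lam i) (elem_map m i (m+i))
                   + endo_scale (lam (m+i)) (elem_map m (m+i) i))"
    have D: "is_subspace endo_scale ?D" by (rule is_subspace_derivations)
    have plusD: "x + y \<in> ?D" if "x \<in> ?D" "y \<in> ?D" for x y
      using D that unfolding is_subspace_def by blast
    have \<tau>D: "\<tau> \<in> ?D"
    proof -
      have eq: "\<tau> = heis_B0 m + (\<Sum>i=1..m. endo_scale (lam i) (elem_map m i (m+i))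
                   + endo_scale (lam (m+i)) (elem_map m (m+i) i))"
        unfolding \<tau>_def heis_B0_def sum.distrib by (simp add: add.assoc)
      have "elem_map m i (m+i) \<in> ?D" "elem_map m (m+i) i \<in> ?D" if "i \<in> {1..m}" for i
        using that heis_B_subset_derivations[of m] unfolding heis_B_def heis_B_squares_def by auto
      then have "(\<Sum>i=1..m. endo_scale (lam i) (elem_map m i (m+i))
                   + endo_scale (lam (m+i)) (elem_map m (m+i) i)) \<in> ?D"
        using D by (intro is_subspace_sum_closed[OF D]) (simp add: is_subspace_def)
      then show ?thesis unfolding eq by (rule plusD[OF heis_B0_derivation])
    qed
    have \<tau>n: "entry \<tau> ?n ?n = 1" by (simp add: \<tau>_def entry_elem_map)
    have \<tau>e: "entry \<tau> (m+i) i = lam i" "entry \<tau> i (m+i) = lam (m+i)" if i: "i \<in> {1..m}" for i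
      using i by (simp_all add: \<tau>_def entry_elem_map if_distrib cong: if_cong)
    let ?L = "LinearCombinations.module.span class_ring (heis_H1 m) {heis_class m \<tau>}"
    have L: "?L = heis_class m ` range (\<lambda>c. endo_scale c \<tau>)" by (rule span_single_class[OF \<tau>D])
    have W: "heis_W m = heis_class m ` (W_derivations m :: 'f endo set)" by (rule heis_W_eq[OF m])
    have add: "heis_class m x \<oplus>\<^bsub>heis_H1 m\<^esub> heis_class m y = heis_class m (x + y)" for x y :: "'f endo"
      by (simp add: H1_def H1_class_def quotient_space_def coset_of_add[OF is_subspace_inner_derivations])
    have sW: "subspace class_ring (heis_W m) (heis_H1 m :: ('f, _) module)"
      unfolding W H1_def H1_class_def
      by (rule subspace_quotient_space[OF vector_space_endo_scale D is_subspace_inner_derivations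
            is_subspace_W_derivations]) (auto simp: W_derivations_def)
    have sL: "subspace class_ring ?L (heis_H1 m)"
      using H.span_is_submodule[of "{heis_class m \<tau>}"] heis_class_in_H1[OF \<tau>D]
        vectorspace_heis_H1[of m, where 'f = 'f] by (simp add: subspace_def)
    have sum: "heis_H1_restricted m lam = H.submodule_sum (heis_W m) ?L"
    proof -
      have "\<psi> \<in> ?R \<longleftrightarrow> (\<exists>\<omega>\<in>W_derivations m. \<exists>c. \<psi> = \<omega> + endo_scale c \<tau>)" for \<psi>
      proof
        assume \<psi>: "\<psi> \<in> ?R"
        let ?c = "entry \<psi> ?n ?n"
        have "endo_scale ?c \<tau> \<in> ?D" using D \<tau>D by (simp add: is_subspace_def)
        then have "\<psi> - endo_scale ?c \<tau> \<in> ?D"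
          using is_subspace_diff[OF vector_space_endo_scale D] \<psi> RsubD by blast
        then have "\<psi> - endo_scale ?c \<tau> \<in> W_derivations m"
          using \<psi> \<tau>n by (auto simp: R_iff W_derivations_def \<tau>e)
        then show "\<exists>\<omega>\<in>W_derivations m. \<exists>c. \<psi> = \<omega> + endo_scale c \<tau>"
          by (metis diff_add_cancel)
      next
        assume "\<exists>\<omega>\<in>W_derivations m. \<exists>c. \<psi> = \<omega> + endo_scale c \<tau>"
        then show "\<psi> \<in> ?R"
          using D \<tau>D \<tau>n l0 by (auto simp: R_iff W_derivations_def \<tau>e is_subspace_def)
      qed
      then have "?R = {\<omega> + endo_scale c \<tau> | \<omega> c. \<omega> \<in> W_derivations m}" by blast
      then show ?thesis
        unfolding H1_restricted_def H.submodule_sum_def W L by (force simp: add)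
    qed
    have inner: "entry \<nu> ?n ?n = 0" if "\<nu> \<in> ?N" for \<nu>
      using that unit_vector_in_heis[of ?n m, where 'a = 'f]
      by (auto simp: inner_derivations_def entry_def ad_map_def heis_bracket_def vscale_def
          unit_vector_def intro!: sum.neutral)
    have "heis_W m \<inter> ?L \<subseteq> {?N}"
    proof
      fix A assume "A \<in> heis_W m \<inter> ?L"
      then obtain \<omega> c where \<omega>: "\<omega> \<in> W_derivations m" "A = heis_class m \<omega>"
        and c: "A = heis_class m (endo_scale c \<tau>)" unfolding W L by auto
      have "0 \<in> ?N" using is_subspace_inner_derivations by (auto simp: is_subspace_def)
      then have "endo_scale c \<tau> \<in> heis_class m \<omega>"
        using \<omega> c unfolding H1_class_def coset_of_def by (metis (mono_tags, lifting) add.right_neutral mem_Collect_eq)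
      then obtain \<nu> where "\<nu> \<in> ?N" "endo_scale c \<tau> = \<omega> + \<nu>"
        by (auto simp: H1_class_def coset_of_def)
      then have "entry (endo_scale c \<tau>) ?n ?n = 0" using \<omega> inner by (simp add: W_derivations_def)
      then have "c = 0" using \<tau>n by simp
      then show "A \<in> {?N}" using c by (simp add: H1_class_def coset_of_zero)
    qed
    moreover have zero: "\<zero>\<^bsub>heis_H1 m\<^esub> = ?N" by (simp add: H1_def quotient_space_def)
    moreover have "?N \<in> heis_W m" "?N \<in> ?L"
      using sW sL zero by (auto simp: subspace_def submodule_def)
    ultimately have "heis_W m \<inter> ?L = {\<zero>\<^bsub>heis_H1 m\<^esub>}" by auto
    with sW sL sum show ?thesis unfolding internal_direct_sum_def \<tau>_def by blast
  qed
  ultimately show ?thesis by blast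
qed

end
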